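(* Let $n\ge1$ and let $X$ be a nonempty set equipped with two $\mathbb{R}^n$-valued vector metrics: a vector $B_1$-metric $d_1$ and a vector $B_2$-metric $d_2$, where $B_1,B_2\in\mathcal{M}_{n\times n}(\mathbb{R})$ and $B_2$ is either positive or inverse-positive. Let $N\colon X\to X$ be an operator. Assume that: (i) $(X,d_1)$ is a complete vector $B_1$-metric space; (ii) $d_1(x,y)\le C\,d_2(x,y)$ for all $x,y\in X$ and some matrix $C\in\mathcal{M}_{n\times n}(\mathbb{R})$; (iii) there exists a matrix $A$ convergent to zero such that $d_2(N(x),N(y))\le A\,d_2(x,y)$ for all $x,y\in X$; (iv) the operator $N$ is continuous in $(X,d_1)$. Then $N$ has a unique fixed point.
   Context: Vectors in $\mathbb{R}^n$ are columns; inequalities between vectors (and between matrices of the same size) and convergence of sequences of vectors or matrices are understood componentwise; $\mathbb{R}_+=[0,\infty)$. For a set $X$ and an arbitrary matrix $B\in\mathcal{M}_{n\times n}(\mathbb{R})$, a vector $B$-metric on $X$ is a mapping $d\colon X\times X\to\mathbb{R}^n_+$ such that for all $u,v,w\in X$: $d(u,v)=0$ if and only if $u=v$; $d(u,v)=d(v,u)$; and $d(u,w)\le B\,(d(u,v)+d(v,w))$. Then $(X,d)$ is called a vector $B$-metric space. A sequence $(x_k)$ converges to $x$ in $(X,d)$ if $d(x_k,x)\to 0$; it is Cauchy if $d(x_k,x_p)\to0$ as $k,p\to\infty$; $(X,d)$ is complete if every Cauchy sequence converges to a point of $X$. Continuity is in the sequential sense: $N$ is continuous in $(X,d_1)$ if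 $d_1(x_k,x)\to0$ implies $d_1(N(x_k),N(x))\to0$. A matrix is positive if all its entries are nonnegative; a square real matrix is inverse-positive if it is invertible and its inverse is positive; a positive matrix $M$ is convergent to zero if $M^k\to 0$ as $k\to\infty$ (so a matrix convergent to zero has, by definition, nonnegative entries). *)

theory Defs
  imports "HOL-Analysis.Analysis"
begin

text \<open>
  The order and the topology that the library puts on \<open>real ^ 'n\<close> and on \<open>real ^ 'n ^ 'n\<close>
  are the componentwise ones; they are used throughout for vectors and matrices.
  A distance \<open>d\<close> on a set \<open>X\<close> is a function on the whole type of which only the values
  on \<open>X\<close> are relevant.
\<close>

definition vector_B_metric ::
  "'a set \<Rightarrow> real ^ 'n ^ 'n \<Rightarrow> ('a \<Rightarrow> 'a \<Rightarrow> real ^ 'n) \<Rightarrow> bool"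
  where
  "vector_B_metric X B d \<longleftrightarrow>
     (\<forall>u\<in>X. \<forall>v\<in>X. 0 \<le> d u v) \<and>
     (\<forall>u\<in>X. \<forall>v\<in>X. d u v = 0 \<longleftrightarrow> u = v) \<and>
     (\<forall>u\<in>X. \<forall>v\<in>X. d u v = d v u) \<and>
     (\<forall>u\<in>X. \<forall>v\<in>X. \<forall>w\<in>X. d u w \<le> B *v (d u v + d v w))"

definition vector_convergent_to ::
  "('a \<Rightarrow> 'a \<Rightarrow> real ^ 'n) \<Rightarrow> (nat \<Rightarrow> 'a) \<Rightarrow> 'a \<Rightarrow> bool"
  where
  "vector_convergent_to d x l \<longleftrightarrow> (\<lambda>k. d (x k) l) \<longlonglongrightarrow> 0"

definition vector_Cauchy :: "('a \<Rightarrow> 'a \<Rightarrow> real ^ 'n) \<Rightarrow> (nat \<Rightarrow> 'a) \<Rightarrow> bool"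
  where
  "vector_Cauchy d x \<longleftrightarrow>
     ((\<lambda>(k, p). d (x k) (x p)) \<longlongrightarrow> 0) (sequentially \<times>\<^sub>F sequentially)"

definition vector_complete :: "'a set \<Rightarrow> ('a \<Rightarrow> 'a \<Rightarrow> real ^ 'n) \<Rightarrow> bool"
  where
  "vector_complete X d \<longleftrightarrow>
     (\<forall>x. range x \<subseteq> X \<and> vector_Cauchy d x \<longrightarrow> (\<exists>l\<in>X. vector_convergent_to d x l))"

definition vector_continuous ::
  "'a set \<Rightarrow> ('a \<Rightarrow> 'a \<Rightarrow> real ^ 'n) \<Rightarrow> ('a \<Rightarrow> 'a) \<Rightarrow> bool"
  where
  "vector_continuous X d N \<longleftrightarrow>
     (\<forall>x l. range x \<subseteq> X \<and> l \<in> X \<and> vector_convergent_to d x l \<longrightarrow>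
        vector_convergent_to d (\<lambda>k. N (x k)) (N l))"

text \<open>``Positive'' means that all entries are nonnegative.\<close>

definition positive_matrix :: "real ^ 'n ^ 'n \<Rightarrow> bool"
  where "positive_matrix M \<longleftrightarrow> (\<forall>i j. 0 \<le> M $ i $ j)"

definition inverse_positive :: "real ^ 'n ^ 'n \<Rightarrow> bool"
  where "inverse_positive M \<longleftrightarrow> invertible M \<and> positive_matrix (matrix_inv M)"

text \<open>
  The library's \<open>M ^ k\<close> on \<open>real ^ 'n ^ 'n\<close> is the entrywise power, because \<open>*\<close> is
  multiplication of entries; the power with respect to the matrix product \<open>**\<close> is:
\<close>

primrec matrix_power :: "real ^ 'n ^ 'n \<Rightarrow> nat \<Rightarrow> real ^ 'n ^ 'n"
  where
    "matrix_power M 0 = mat 1"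
  | "matrix_power M (Suc k) = M ** matrix_power M k"

definition convergent_to_zero :: "real ^ 'n ^ 'n \<Rightarrow> bool"
  where
  "convergent_to_zero M \<longleftrightarrow> positive_matrix M \<and> (\<lambda>k. matrix_power M k) \<longlonglongrightarrow> 0"

end

theory Submission
  imports Defs
begin

text \<open>
  The componentwise order makes the problem scalar. The Euclidean norm is monotone on the
  nonnegative orthant, so for a vector \<open>B\<close>-metric \<open>d\<close> the numbers \<open>norm (d u v)\<close> satisfy
  the relaxed triangle inequality of a real-valued b-metric with constant \<open>norm B\<close>, the
  Frobenius norm of \<open>B\<close> (\<open>vector_B_metric_norm_triangle\<close>).

  In these terms, \<open>norm (d2 (N^k u) (N^k v)) \<le> norm (A^k) * norm (d2 u v)\<close>, where
  \<open>norm (A^k)\<close> tends to \<open>0\<close>. Summing the increments \<open>d2 (N^k x) (N^(k+1) x)\<close>, as one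
  does in a metric space, would accumulate powers of the constant \<open>K\<close> of the triangle inequality.
  Instead, some iterate \<open>N^m\<close> contracts by a factor at most \<open>1 / (2K)\<close>, and a single use of
  the triangle inequality then shows that every orbit is bounded
  (\<open>b_metric_orbit_bounded\<close>). If \<open>R\<close> bounds the distances from \<open>x\<close> to its orbit, then
  \<open>norm (d2 (N^k x) (N^(k+j) x)) \<le> norm (A^k) * R\<close> for all \<open>j\<close>, so the orbit is Cauchy
  for \<open>d2\<close>, hence for \<open>d1\<close>. Its \<open>d1\<close>-limit is a fixed point by continuity of \<open>N\<close> and
  uniqueness of limits. Two fixed points are not moved by \<open>N^k\<close>, so the norm of their
  \<open>d2\<close>-distance \<open>t\<close> satisfies \<open>t \<le> norm (A^k) * t\<close> for all \<open>k\<close>, whence \<open>t = 0\<close>.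
\<close>

lemma norm_mono_nonneg_vec:
  fixes a b :: "real ^ 'n"
  assumes "0 \<le> a" "a \<le> b"
  shows "norm a \<le> norm b"
proof (rule norm_le_componentwise_cart)
  fix i
  have "0 \<le> a $ i" "a $ i \<le> b $ i"
    using assms by (simp_all add: less_eq_vec_def)
  then show "norm (a $ i) \<le> norm (b $ i)"
    by simp
qed

lemma norm_matrix_vector_mult_le:
  fixes M :: "real ^ 'n ^ 'm"
  shows "norm (M *v x) \<le> norm M * norm x"
proof -
  have "norm (M *v x) \<le> L2_set (\<lambda>i. norm (M $ i) * norm x) UNIV"
    unfolding norm_vec_def[of "M *v x"]
    by (intro L2_set_mono)
       (auto simp: matrix_vector_mul_component Cauchy_Schwarz_ineq2)
  also have "\<dots> = norm M * norm x"
    by (simp add: norm_vec_def[of M] L2_set_left_distrib)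
  finally show ?thesis .
qed

lemma positive_matrix_mult_mono:
  assumes "positive_matrix M" "a \<le> b"
  shows "M *v a \<le> M *v b"
  using assms
  by (auto simp: positive_matrix_def less_eq_vec_def matrix_vector_mult_def
      intro!: sum_mono mult_left_mono)

lemma vector_B_metric_norm_triangle:
  assumes "vector_B_metric X B d" "u \<in> X" "v \<in> X" "w \<in> X"
  shows "norm (d u w) \<le> norm B * (norm (d u v) + norm (d v w))"
proof -
  have "norm (d u w) \<le> norm (B *v (d u v + d v w))"
    using assms by (intro norm_mono_nonneg_vec) (auto simp: vector_B_metric_def)
  also have "\<dots> \<le> norm B * norm (d u v + d v w)"
    by (rule norm_matrix_vector_mult_le)
  also have "\<dots> \<le> norm B * (norm (d u v) + norm (d v w))"
    by (intro mult_left_mono norm_triangle_ineq) simp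
  finally show ?thesis .
qed

lemma vector_limit_unique:
  assumes d: "vector_B_metric X B d"
    and X: "range x \<subseteq> X" "u \<in> X" "w \<in> X"
    and lim: "vector_convergent_to d x u" "vector_convergent_to d x w"
  shows "u = w"
proof -
  have "(\<lambda>k. norm B * (norm (d (x k) u) + norm (d (x k) w))) \<longlonglongrightarrow> norm B * (0 + 0)"
    using lim unfolding vector_convergent_to_def
    by (intro tendsto_intros) (auto dest: tendsto_norm)
  moreover have "norm (d u w) \<le> norm B * (norm (d (x k) u) + norm (d (x k) w))" for k
  proof -
    have "x k \<in> X"
      using X(1) by auto
    moreover have "d (x k) u = d u (x k)"
      using d X(2) \<open>x k \<in> X\<close> by (simp add: vector_B_metric_def)
    ultimately show ?thesis
      using vector_B_metric_norm_triangle[OF d, of u "x k" w] X by simp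
  qed
  ultimately have "norm (d u w) \<le> norm B * (0 + 0)"
    by (intro LIMSEQ_le_const) auto
  then have "d u w = 0"
    by simp
  then show ?thesis
    using d X by (auto simp: vector_B_metric_def)
qed

text \<open>
  For \<open>k \<ge> m\<close>, the point \<open>N^k x\<close> is the image
  of \<open>N^(k-m) x\<close>, so passing through \<open>N^m x\<close> bounds the distance from \<open>x\<close> to \<open>N^k x\<close> by
  a constant plus half of the distance from \<open>x\<close> to \<open>N^(k-m) x\<close>. A sequence with
  this recursion stays below twice the constant as soon as its first \<open>m\<close> values do, which
  choosing the constant large enough ensures.
\<close>

lemma b_metric_orbit_bounded:
  fixes \<delta> :: "'a \<Rightarrow> 'a \<Rightarrow> real"
  assumes N: "N \<in> X \<rightarrow> X" and x: "x \<in> X"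
    and nonneg: "\<And>u v. u \<in> X \<Longrightarrow> v \<in> X \<Longrightarrow> 0 \<le> \<delta> u v"
    and tri: "\<And>u v w. u \<in> X \<Longrightarrow> v \<in> X \<Longrightarrow> w \<in> X \<Longrightarrow> \<delta> u w \<le> K * (\<delta> u v + \<delta> v w)"
    and K: "1 \<le> K"
    and contr: "\<And>u v. u \<in> X \<Longrightarrow> v \<in> X \<Longrightarrow> \<delta> ((N ^^ m) u) ((N ^^ m) v) \<le> c * \<delta> u v"
    and c: "K * c \<le> 1 / 2" and m: "0 < m"
  obtains R where "\<And>k. \<delta> x ((N ^^ k) x) \<le> R"
proof -
  have orbit: "(N ^^ k) x \<in> X" for k
    using N x by (induction k) auto
  define S where "S = (\<Sum>k\<le>m. \<delta> x ((N ^^ k) x))"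
  have S: "\<delta> x ((N ^^ k) x) \<le> S" if "k \<le> m" for k
    unfolding S_def using that nonneg[OF x orbit] by (intro member_le_sum) auto
  have "0 \<le> S"
    unfolding S_def using nonneg[OF x orbit] by (intro sum_nonneg) auto
  have "\<delta> x ((N ^^ k) x) \<le> 2 * K * S" for k
  proof (induction k rule: less_induct)
    case (less k)
    show ?case
    proof (cases "k \<le> m")
      case True
      have "1 * S \<le> 2 * K * S"
        using K \<open>0 \<le> S\<close> by (intro mult_right_mono) auto
      then show ?thesis
        using S[OF True] by simp
    next
      case False
      let ?y = "(N ^^ (k - m)) x"
      have k: "(N ^^ k) x = (N ^^ m) ?y"
        using False funpow_add[of m "k - m" N] by simp
      have "\<delta> x ((N ^^ k) x) \<le> K * (\<delta> x ((N ^^ m) x) + \<delta> ((N ^^ m) x) ((N ^^ m) ?y))"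
        using tri[OF x orbit[of m] orbit[of k]] k by simp
      also have "\<dots> \<le> K * (S + c * \<delta> x ?y)"
        using K S[of m] contr[OF x orbit] by (intro mult_left_mono add_mono) auto
      also have "\<dots> = K * S + K * c * \<delta> x ?y"
        by (simp add: algebra_simps)
      also have "\<dots> \<le> K * S + 1 / 2 * (2 * K * S)"
      proof -
        have "K * c * \<delta> x ?y \<le> 1 / 2 * \<delta> x ?y"
          using c nonneg[OF x orbit] by (intro mult_right_mono) auto
        moreover have "\<delta> x ?y \<le> 2 * K * S"
          using less.IH[of "k - m"] m False by simp
        ultimately show ?thesis
          by simp
      qed
      finally show ?thesis
        by simp
    qed
  qed
  then show ?thesis
    using that by blast
qed

lemma funpow_matrix_contraction:
  assumes N: "N \<in> X \<rightarrow> X" and A: "positive_matrix A"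
    and contr: "\<And>u v. u \<in> X \<Longrightarrow> v \<in> X \<Longrightarrow> d (N u) (N v) \<le> A *v d u v"
    and uv: "u \<in> X" "v \<in> X"
  shows "d ((N ^^ k) u) ((N ^^ k) v) \<le> matrix_power A k *v d u v"
proof (induction k)
  case 0
  then show ?case by simp
next
  case (Suc k)
  have X: "(N ^^ k) w \<in> X" if "w \<in> X" for w
    using N that by (induction k) auto
  have "d ((N ^^ Suc k) u) ((N ^^ Suc k) v) \<le> A *v d ((N ^^ k) u) ((N ^^ k) v)"
    using contr X uv by simp
  also have "\<dots> \<le> A *v (matrix_power A k *v d u v)"
    by (intro positive_matrix_mult_mono A Suc.IH)
  finally show ?case
    by (simp add: matrix_vector_mul_assoc)
qed

theorem theorem3p3:
  fixes X :: "'a set"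
    and d1 d2 :: "'a \<Rightarrow> 'a \<Rightarrow> real ^ 'n"
    and B1 B2 :: "real ^ 'n ^ 'n"
    and N :: "'a \<Rightarrow> 'a"
  assumes "X \<noteq> {}"
    and "vector_B_metric X B1 d1"
    and "vector_B_metric X B2 d2"
    and "positive_matrix B2 \<or> inverse_positive B2"
    and "N \<in> X \<rightarrow> X"
    and "vector_complete X d1"
    and "\<exists>C :: real ^ 'n ^ 'n. \<forall>x\<in>X. \<forall>y\<in>X. d1 x y \<le> C *v d2 x y"
    and "\<exists>A :: real ^ 'n ^ 'n. convergent_to_zero A \<and>
           (\<forall>x\<in>X. \<forall>y\<in>X. d2 (N x) (N y) \<le> A *v d2 x y)"
    and "vector_continuous X d1 N"
  shows "\<exists>!x. x \<in> X \<and> N x = x"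
proof -
  note d1 = assms(2) and d2 = assms(3) and N = assms(5)
  obtain C :: "real ^ 'n ^ 'n" where C: "\<And>u v. u \<in> X \<Longrightarrow> v \<in> X \<Longrightarrow> d1 u v \<le> C *v d2 u v"
    using assms(7) by blast
  obtain A :: "real ^ 'n ^ 'n" where A: "positive_matrix A" "matrix_power A \<longlonglongrightarrow> 0"
    and contr: "\<And>u v. u \<in> X \<Longrightarrow> v \<in> X \<Longrightarrow> d2 (N u) (N v) \<le> A *v d2 u v"
    using assms(8) by (auto simp: convergent_to_zero_def)
  define a where "a k = norm (matrix_power A k)" for k
  have a: "a \<longlonglongrightarrow> 0"
    unfolding a_def using tendsto_norm[OF A(2)] by simp
  have NX: "(N ^^ k) u \<in> X" if "u \<in> X" for u k
    using N that by (induction k) auto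
  have d2_pow: "norm (d2 ((N ^^ k) u) ((N ^^ k) v)) \<le> a k * norm (d2 u v)"
    if "u \<in> X" "v \<in> X" for u v k
  proof -
    have "norm (d2 ((N ^^ k) u) ((N ^^ k) v)) \<le> norm (matrix_power A k *v d2 u v)"
      using funpow_matrix_contraction[where d = d2, OF N A(1) contr that] d2 NX that
      by (intro norm_mono_nonneg_vec) (auto simp: vector_B_metric_def)
    then show ?thesis
      using norm_matrix_vector_mult_le[of "matrix_power A k" "d2 u v"] by (simp add: a_def)
  qed

  obtain x where x: "x \<in> X"
    using assms(1) by blast
  obtain R where R: "\<And>k. norm (d2 x ((N ^^ k) x)) \<le> R"
  proof -
    \<comment> \<open>The summand 1 gives \<open>1 \<le> K\<close>, which the bound on the first \<open>m\<close> points of the orbit uses.\<close>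
    define K where "K = norm B2 + 1"
    have "0 < K"
      by (simp add: K_def add_nonneg_pos)
    have "eventually (\<lambda>m. a m < 1 / (2 * K)) sequentially"
      by (rule order_tendstoD(2)[OF a]) (simp add: \<open>0 < K\<close>)
    then have "eventually (\<lambda>m. a m < 1 / (2 * K) \<and> 0 < m) sequentially"
      using eventually_gt_at_top eventually_conj by blast
    then obtain m where m: "a m < 1 / (2 * K)" "0 < m"
      by (auto simp: eventually_sequentially)
    have "K * a m \<le> 1 / 2"
      using m(1) \<open>0 < K\<close> by (simp add: field_simps)
    moreover have "norm (d2 u w) \<le> K * (norm (d2 u v) + norm (d2 v w))"
      if "u \<in> X" "v \<in> X" "w \<in> X" for u v w
      using vector_B_metric_norm_triangle[OF d2 that] unfolding K_def
      by (simp add: distrib_right add_increasing2)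
    ultimately show ?thesis
      using b_metric_orbit_bounded[of N X x "\<lambda>u v. norm (d2 u v)" K m "a m"]
        N x d2_pow m(2) that by (auto simp: K_def)
  qed

  define orb where "orb k = (N ^^ k) x" for k
  have orb: "orb k \<in> X" for k
    using NX x by (simp add: orb_def)
  have tail: "norm (d1 (orb k) (orb p)) \<le> norm C * (a k * R)" if "k \<le> p" for k p
  proof -
    have "orb p = (N ^^ k) ((N ^^ (p - k)) x)"
      using that funpow_add[of k "p - k" N] by (simp add: orb_def)
    then have "norm (d2 (orb k) (orb p)) \<le> a k * norm (d2 x ((N ^^ (p - k)) x))"
      using d2_pow[OF x NX[OF x]] by (simp add: orb_def)
    also have "\<dots> \<le> a k * R"
      using R by (intro mult_left_mono) (auto simp: a_def)
    finally have "norm C * norm (d2 (orb k) (orb p)) \<le> norm C * (a k * R)"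
      by (rule mult_left_mono) simp
    moreover have "norm (d1 (orb k) (orb p)) \<le> norm (C *v d2 (orb k) (orb p))"
      using C orb d1 by (intro norm_mono_nonneg_vec) (auto simp: vector_B_metric_def)
    ultimately show ?thesis
      using norm_matrix_vector_mult_le[of C "d2 (orb k) (orb p)"] by linarith
  qed
  have "vector_Cauchy d1 orb"
  proof -
    have bound: "norm (d1 (orb k) (orb p)) \<le> norm C * (a k * R) + norm C * (a p * R)" for k p
    proof -
      have "0 \<le> R"
        using R[of 0] norm_ge_zero order_trans by blast
      then have "0 \<le> norm C * (a i * R)" for i
        by (simp add: a_def)
      moreover have "d1 (orb k) (orb p) = d1 (orb p) (orb k)"
        using d1 orb by (auto simp: vector_B_metric_def)
      ultimately show ?thesis
        using tail[of k p] tail[of p k] by (metis add_increasing add_increasing2 nat_le_linear)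
    qed
    have "((\<lambda>z. norm C * (a (fst z) * R) + norm C * (a (snd z) * R)) \<longlongrightarrow>
        norm C * (0 * R) + norm C * (0 * R)) (sequentially \<times>\<^sub>F sequentially)"
      by (intro tendsto_add tendsto_mult tendsto_const
          filterlim_compose[OF a filterlim_fst] filterlim_compose[OF a filterlim_snd])
    then have "((\<lambda>z. norm C * (a (fst z) * R) + norm C * (a (snd z) * R)) \<longlongrightarrow> 0)
        (sequentially \<times>\<^sub>F sequentially)"
      by (simp only: mult_zero_left mult_zero_right add_0)
    then show ?thesis
      unfolding vector_Cauchy_def
      by (rule Lim_null_comparison[rotated]) (simp add: case_prod_beta bound)
  qed
  then obtain l where l: "l \<in> X" "vector_convergent_to d1 orb l"
    using assms(6) orb by (auto simp: vector_complete_def image_subset_iff)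
  have "vector_convergent_to d1 (\<lambda>k. N (orb k)) (N l)"
    using assms(9) orb l by (simp add: vector_continuous_def image_subset_iff)
  then have "vector_convergent_to d1 (\<lambda>k. orb (Suc k)) (N l)"
    by (simp add: orb_def)
  moreover have "vector_convergent_to d1 (\<lambda>k. orb (Suc k)) l"
    using l(2) unfolding vector_convergent_to_def by (rule LIMSEQ_Suc)
  ultimately have fix_l: "N l = l"
    using vector_limit_unique[OF d1, of "\<lambda>k. orb (Suc k)"] orb N l(1) by blast

  have "u = v" if "u \<in> X" "N u = u" "v \<in> X" "N v = v" for u v
  proof -
    have "(N ^^ k) w = w" if "N w = w" for w k
      using that by (induction k) auto
    then have "norm (d2 u v) \<le> a k * norm (d2 u v)" for k
      using d2_pow[of u v k] that by simp
    moreover have "(\<lambda>k. a k * norm (d2 u v)) \<longlonglongrightarrow> 0 * norm (d2 u v)"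
      by (intro tendsto_intros a)
    ultimately have "norm (d2 u v) \<le> 0 * norm (d2 u v)"
      by (intro LIMSEQ_le_const) auto
    then show ?thesis
      using d2 that by (auto simp: vector_B_metric_def)
  qed
  then show ?thesis
    using l(1) fix_l by blast
qed

end
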